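(* Let $B$ be a Bernstein subset of $\mathbb{R}$ that is a subgroup of $(\mathbb{R},+)$, and let $\mathcal{B}=\mathbb{R}/B=\{B+x:x\in\mathbb{R}\}$. Then the families $\mathcal{S}(\mathcal{B})*\mathcal{N}_0$ and $\mathcal{N}_0*\mathcal{S}(\mathcal{B})$ are semigroups of sets on $\mathbb{R}$ such that $\mathcal{S}(\mathcal{B})\subseteq \mathcal{N}_0*\mathcal{S}(\mathcal{B})\subseteq \mathcal{S}(\mathcal{B})*\mathcal{N}_0$. They are invariant under the action of the group $\Phi(\mathbb{R})$ of all translations of $\mathbb{R}$, and they consist of sets which are not Lebesgue measurable.
   Context: A Bernstein set is a subset $B\subseteq\mathbb{R}$ such that $B\cap F\neq\emptyset$ and $(\mathbb{R}\setminus B)\cap F\neq\emptyset$ for every uncountable closed $F\subseteq\mathbb{R}$. For a non-empty family $\mathcal{A}$ of sets, $\mathcal{S}(\mathcal{A})=\{\bigcup_{i=1}^n A_i: A_i\in\mathcal{A}, n\in\mathbb{N}\}$ with $n\ge 1$. For families of sets, $\mathcal{A}*\mathcal{D}=\{(A\setminus D_1)\cup D_2: A\in\mathcal{A}, D_1,D_2\in\mathcal{D}\}$. $\mathcal{N}_0$ is the $\sigma$-ideal of Lebesgue null subsets of $\mathbb{R}$. A semigroup of sets is a non-empty family of sets closed under finite unions. A family $\mathcal{O}$ of subsets of $\mathbb{R}$ is invariant under $\Phi(\mathbb{R})$ if $A+t\in\mathcal{O}$ for all $A\in\mathcal{O}$, $t\in\mathbb{R}$. *)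

theory Defs
  imports "HOL-Analysis.Analysis" "HOL-Algebra.Coset"
begin

definition bernstein :: "real set \<Rightarrow> bool" where
  "bernstein B \<longleftrightarrow>
     (\<forall>F. closed F \<and> uncountable F \<longrightarrow> B \<inter> F \<noteq> {} \<and> (UNIV - B) \<inter> F \<noteq> {})"

definition real_add_group :: "real monoid" where
  "real_add_group = \<lparr>carrier = UNIV, monoid.mult = (+), one = 0\<rparr>"

text \<open>At least one member is required in the union, so the empty set is not added to the family.\<close>

definition finite_unions :: "'a set set \<Rightarrow> 'a set set" where
  "finite_unions \<A> =
     {\<Union>i\<in>{1..n}. A i | (A :: nat \<Rightarrow> 'a set) n. 1 \<le> n \<and> (\<forall>i\<in>{1..n}. A i \<in> \<A>)}"

definition family_star :: "'a set set \<Rightarrow> 'a set set \<Rightarrow> 'a set set" where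
  "family_star \<A> \<D> = {(A - D\<^sub>1) \<union> D\<^sub>2 | A D\<^sub>1 D\<^sub>2. A \<in> \<A> \<and> D\<^sub>1 \<in> \<D> \<and> D\<^sub>2 \<in> \<D>}"

text \<open>Again only non-empty finite unions are meant, so a semigroup need not contain the empty set.\<close>

definition set_semigroup :: "'a set set \<Rightarrow> bool" where
  "set_semigroup \<S> \<longleftrightarrow>
     \<S> \<noteq> {} \<and> (\<forall>\<F>. finite \<F> \<and> \<F> \<noteq> {} \<and> \<F> \<subseteq> \<S> \<longrightarrow> \<Union>\<F> \<in> \<S>)"

definition real_translations :: "(real \<Rightarrow> real) set" where
  "real_translations = {\<lambda>x. x + t | t. True}"

definition invariant_under :: "('a \<Rightarrow> 'a) set \<Rightarrow> 'a set set \<Rightarrow> bool" where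
  "invariant_under \<Phi> \<O> \<longleftrightarrow> (\<forall>A\<in>\<O>. \<forall>h\<in>\<Phi>. h ` A \<in> \<O>)"

end

theory Submission
  imports Defs
begin

text \<open>
  A finite union \<open>U\<close> of cosets of \<open>B\<close> contains one translate of \<open>B\<close>. It also misses one: the
  group of reals is divisible, so its proper subgroup \<open>B\<close> has infinite index. Translates of \<open>B\<close> are
  Bernstein sets, hence neither \<open>U\<close> nor its complement contains an uncountable closed set. If
  \<open>U\<close> were measurable, then by inner regularity both would be null, which is absurd; null
  modifications of \<open>U\<close> do not affect this.
\<close>

section \<open>Finite unions of members and semigroups of sets\<close>

text \<open>The index family is traded for its range: \<open>1 \<le> n\<close> becomes nonemptiness
  of \<open>\<F>\<close>. In this form, closure under unions and images reduces to operations on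
  \<open>\<F>\<close>.\<close>

lemma finite_unions_eq: "finite_unions \<A> = {\<Union>\<F> | \<F>. finite \<F> \<and> \<F> \<noteq> {} \<and> \<F> \<subseteq> \<A>}"
proof (intro subset_antisym subsetI)
  fix X assume "X \<in> finite_unions \<A>"
  then obtain A and n :: nat
    where "X = (\<Union>i\<in>{1..n}. A i)" "1 \<le> n" "\<forall>i\<in>{1..n}. A i \<in> \<A>"
    unfolding finite_unions_def by blast
  then show "X \<in> {\<Union>\<F> | \<F>. finite \<F> \<and> \<F> \<noteq> {} \<and> \<F> \<subseteq> \<A>}"
    by (intro CollectI exI[of _ "A ` {1..n}"]) auto
next
  fix X assume "X \<in> {\<Union>\<F> | \<F>. finite \<F> \<and> \<F> \<noteq> {} \<and> \<F> \<subseteq> \<A>}"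
  then obtain \<F> where \<F>: "X = \<Union>\<F>" "finite \<F>" "\<F> \<noteq> {}" "\<F> \<subseteq> \<A>"
    by blast
  \<comment> \<open>The enumeration starts at 1 to match the index range in
    \<open>finite_unions\<close>.\<close>
  obtain A where A: "bij_betw A {1..card \<F>} \<F>"
    using ex_bij_betw_nat_finite_1[OF \<F>(2)] by blast
  have "1 \<le> card \<F>"
    using \<F> by (simp add: Suc_leI card_gt_0_iff)
  moreover have "A ` {1..card \<F>} = \<F>"
    using A by (rule bij_betw_imp_surj_on)
  ultimately show "X \<in> finite_unions \<A>"
    unfolding finite_unions_def using \<F>
    by (intro CollectI exI[of _ A] exI[of _ "card \<F>"]) auto
qed

lemma finite_unions_Un:
  assumes "X \<in> finite_unions \<A>" "Y \<in> finite_unions \<A>"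
  shows "X \<union> Y \<in> finite_unions \<A>"
proof -
  obtain \<F> \<G> where "X = \<Union>\<F>" "finite \<F>" "\<F> \<noteq> {}" "\<F> \<subseteq> \<A>"
    and "Y = \<Union>\<G>" "finite \<G>" "\<G> \<noteq> {}" "\<G> \<subseteq> \<A>"
    using assms unfolding finite_unions_eq by blast
  then show ?thesis
    unfolding finite_unions_eq by (intro CollectI exI[of _ "\<F> \<union> \<G>"]) auto
qed

lemma finite_unions_nonempty: "\<A> \<noteq> {} \<Longrightarrow> finite_unions \<A> \<noteq> {}"
  unfolding finite_unions_eq by blast

lemma invariant_under_finite_unions:
  assumes "invariant_under \<Phi> \<A>"
  shows "invariant_under \<Phi> (finite_unions \<A>)"
  unfolding invariant_under_def
proof (intro ballI)
  fix X h assume "X \<in> finite_unions \<A>" and h: "h \<in> \<Phi>"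
  then obtain \<F> where "X = \<Union>\<F>" "finite \<F>" "\<F> \<noteq> {}" "\<F> \<subseteq> \<A>"
    unfolding finite_unions_eq by blast
  then show "h ` X \<in> finite_unions \<A>"
    using assms h unfolding finite_unions_eq invariant_under_def
    by (intro CollectI exI[of _ "(`) h ` \<F>"]) (auto simp: image_Union)
qed

lemma set_semigroupI:
  assumes "\<S> \<noteq> {}" and Un: "\<And>X Y. X \<in> \<S> \<Longrightarrow> Y \<in> \<S> \<Longrightarrow> X \<union> Y \<in> \<S>"
  shows "set_semigroup \<S>"
proof -
  have "\<Union>\<F> \<in> \<S>" if "finite \<F>" "\<F> \<noteq> {}" "\<F> \<subseteq> \<S>" for \<F>
    using that by (induction rule: finite_ne_induct) (auto intro: Un)
  then show ?thesis
    using assms(1) unfolding set_semigroup_def by blast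
qed

section \<open>The star operation and null sets\<close>

lemma family_starI:
  "X = (A - D) \<union> E \<Longrightarrow> A \<in> \<A> \<Longrightarrow> D \<in> \<D> \<Longrightarrow> E \<in> \<D> \<Longrightarrow> X \<in> family_star \<A> \<D>"
  unfolding family_star_def by blast

text \<open>Images always commute with unions, but with differences only for injective maps; hence
  the last assumption.\<close>

lemma invariant_under_family_star:
  assumes "invariant_under \<Phi> \<A>" "invariant_under \<Phi> \<D>" and "\<And>h. h \<in> \<Phi> \<Longrightarrow> inj h"
  shows "invariant_under \<Phi> (family_star \<A> \<D>)"
  unfolding invariant_under_def
proof (intro ballI)
  fix X h assume "X \<in> family_star \<A> \<D>" and h: "h \<in> \<Phi>"
  then obtain A D E where "X = (A - D) \<union> E" "A \<in> \<A>" "D \<in> \<D>" "E \<in> \<D>"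
    unfolding family_star_def by blast
  moreover from this have "h ` X = (h ` A - h ` D) \<union> h ` E"
    using assms(3)[OF h] by (simp add: image_Un image_set_diff)
  ultimately show "h ` X \<in> family_star \<A> \<D>"
    using assms(1,2) h unfolding invariant_under_def
    by (intro family_starI[of _ "h ` A" "h ` D" "h ` E"]) auto
qed

text \<open>Lebesgue measure is complete, so every subset of a null set is null. Thus
  \<open>A - X \<subseteq> D\<close> and \<open>X - A \<subseteq> E\<close> are themselves null, and
  they can replace the sets \<open>D\<close> and \<open>E\<close> as the canonical modification
  taking \<open>A\<close> to \<open>X\<close>.\<close>

lemma family_star_null_sets_right:
  "family_star \<A> (null_sets lebesgue) =
    {X. \<exists>A\<in>\<A>. A - X \<in> null_sets lebesgue \<and> X - A \<in> null_sets lebesgue}" for \<A> :: "real set set"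
proof (intro subset_antisym subsetI)
  fix X assume "X \<in> family_star \<A> (null_sets lebesgue)"
  then obtain A D E where X: "X = (A - D) \<union> E" "A \<in> \<A>"
    "D \<in> null_sets lebesgue" "E \<in> null_sets lebesgue"
    unfolding family_star_def by blast
  have "A - X \<in> null_sets lebesgue"
    by (rule null_sets_completion_subset[OF _ X(3)]) (use X in auto)
  moreover have "X - A \<in> null_sets lebesgue"
    by (rule null_sets_completion_subset[OF _ X(4)]) (use X in auto)
  ultimately show "X \<in> {X. \<exists>A\<in>\<A>. A - X \<in> null_sets lebesgue \<and> X - A \<in> null_sets lebesgue}"
    using X(2) by blast
next
  fix X assume "X \<in> {X. \<exists>A\<in>\<A>. A - X \<in> null_sets lebesgue \<and> X - A \<in> null_sets lebesgue}"
  then obtain A where "A \<in> \<A>" "A - X \<in> null_sets lebesgue" "X - A \<in> null_sets lebesgue"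
    by blast
  moreover have "X = (A - (A - X)) \<union> (X - A)"
    by blast
  ultimately show "X \<in> family_star \<A> (null_sets lebesgue)"
    by (intro family_starI)
qed

text \<open>By completeness, removing any set from a null set leaves a null set, so only the added
  member of \<open>\<A>\<close> matters.\<close>

lemma family_star_null_sets_left:
  "family_star (null_sets lebesgue) \<A> = {K \<union> A | K A. K \<in> null_sets lebesgue \<and> A \<in> \<A>}"
  for \<A> :: "real set set"
proof (intro subset_antisym subsetI)
  fix X assume "X \<in> family_star (null_sets lebesgue) \<A>"
  then obtain K C A where X: "X = (K - C) \<union> A" "K \<in> null_sets lebesgue" "A \<in> \<A>"
    unfolding family_star_def by blast
  have "K - C \<in> null_sets lebesgue"
    by (rule null_sets_completion_subset[OF _ X(2)]) auto
  with X show "X \<in> {K \<union> A | K A. K \<in> null_sets lebesgue \<and> A \<in> \<A>}"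
    by blast
next
  fix X assume "X \<in> {K \<union> A | K A. K \<in> null_sets lebesgue \<and> A \<in> \<A>}"
  then obtain K A where "X = K \<union> A" "K \<in> null_sets lebesgue" "A \<in> \<A>"
    by blast
  moreover from this have "X = (K - A) \<union> A"
    by blast
  ultimately show "X \<in> family_star (null_sets lebesgue) \<A>"
    by (intro family_starI)
qed

text \<open>The roles swap: \<open>A\<close> becomes the base, the null set \<open>K\<close> is
  added, and the empty set is removed.\<close>

lemma family_star_null_sets_left_subset_right:
  "family_star (null_sets lebesgue) \<A> \<subseteq> family_star \<A> (null_sets lebesgue)"
  for \<A> :: "real set set"
proof
  fix X assume "X \<in> family_star (null_sets lebesgue) \<A>"
  then obtain K A where X: "X = K \<union> A" "K \<in> null_sets lebesgue" "A \<in> \<A>"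
    unfolding family_star_null_sets_left by blast
  then have "X = (A - {}) \<union> K"
    by blast
  then show "X \<in> family_star \<A> (null_sets lebesgue)"
    using X null_sets.empty_sets by (intro family_starI)
qed

lemma subset_family_star_null_sets_left: "\<A> \<subseteq> family_star (null_sets lebesgue) \<A>"
  for \<A> :: "real set set"
  unfolding family_star_null_sets_left using null_sets.empty_sets by blast

text \<open>Errors only accumulate under unions: each one-sided difference between
  \<open>A \<union> C\<close> and \<open>X \<union> Y\<close> lies in the union of the two
  corresponding differences, which is null.\<close>

lemma set_semigroup_family_star_null_sets_right:
  fixes \<A> :: "real set set"
  assumes "\<A> \<noteq> {}" and Un: "\<And>X Y. X \<in> \<A> \<Longrightarrow> Y \<in> \<A> \<Longrightarrow> X \<union> Y \<in> \<A>"
  shows "set_semigroup (family_star \<A> (null_sets lebesgue))"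
proof (rule set_semigroupI)
  show "family_star \<A> (null_sets lebesgue) \<noteq> {}"
    using assms(1) subset_family_star_null_sets_left family_star_null_sets_left_subset_right
    by blast
  fix X Y assume "X \<in> family_star \<A> (null_sets lebesgue)" "Y \<in> family_star \<A> (null_sets lebesgue)"
  then obtain A C where "A \<in> \<A>" "C \<in> \<A>"
    and null: "A - X \<in> null_sets lebesgue" "X - A \<in> null_sets lebesgue"
      "C - Y \<in> null_sets lebesgue" "Y - C \<in> null_sets lebesgue"
    unfolding family_star_null_sets_right by blast
  moreover have "A \<union> C - (X \<union> Y) \<in> null_sets lebesgue"
    by (rule null_sets_completion_subset[OF _ null_sets.Un[OF null(1,3)]]) auto
  moreover have "X \<union> Y - (A \<union> C) \<in> null_sets lebesgue"
    by (rule null_sets_completion_subset[OF _ null_sets.Un[OF null(2,4)]]) auto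
  ultimately show "X \<union> Y \<in> family_star \<A> (null_sets lebesgue)"
    using Un unfolding family_star_null_sets_right by blast
qed

lemma set_semigroup_family_star_null_sets_left:
  fixes \<A> :: "real set set"
  assumes "\<A> \<noteq> {}" and Un: "\<And>X Y. X \<in> \<A> \<Longrightarrow> Y \<in> \<A> \<Longrightarrow> X \<union> Y \<in> \<A>"
  shows "set_semigroup (family_star (null_sets lebesgue) \<A>)"
proof (rule set_semigroupI)
  show "family_star (null_sets lebesgue) \<A> \<noteq> {}"
    using assms(1) subset_family_star_null_sets_left by blast
  fix X Y assume "X \<in> family_star (null_sets lebesgue) \<A>" "Y \<in> family_star (null_sets lebesgue) \<A>"
  then obtain K L A C where "X = K \<union> A" "Y = L \<union> C" "A \<in> \<A>" "C \<in> \<A>"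
    and "K \<in> null_sets lebesgue" "L \<in> null_sets lebesgue"
    unfolding family_star_null_sets_left by blast
  moreover from this have "X \<union> Y = (K \<union> L) \<union> (A \<union> C)"
    by blast
  ultimately show "X \<union> Y \<in> family_star (null_sets lebesgue) \<A>"
    using Un null_sets.Un unfolding family_star_null_sets_left by blast
qed

section \<open>Translates of null sets and of Bernstein sets\<close>

lemma invariant_under_null_sets: "invariant_under real_translations (null_sets lebesgue)"
  unfolding invariant_under_def real_translations_def
  using negligible_translation by (auto simp: negligible_iff_null_sets[symmetric] add.commute)

lemma inj_real_translations: "h \<in> real_translations \<Longrightarrow> inj h"
  by (auto simp: real_translations_def inj_def)

text \<open>Testing the translate against \<open>F\<close> amounts to testing \<open>B\<close>
  against \<open>F\<close> shifted back by \<open>x\<close>, which is again closed and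
  uncountable.\<close>

lemma bernstein_translation:
  assumes "bernstein B"
  shows "bernstein ((\<lambda>b. b + x) ` B)"
  unfolding bernstein_def
proof (intro allI impI)
  fix F :: "real set" assume F: "closed F \<and> uncountable F"
  define G where "G = (\<lambda>y. y - x) ` F"
  have "closed G"
    using F closed_translation[of F "- x"] by (simp add: G_def)
  moreover have "uncountable G"
    using F unfolding G_def by (subst countable_image_inj_eq) (auto simp: inj_on_def)
  ultimately obtain b c where "b \<in> B" "b \<in> G" "c \<notin> B" "c \<in> G"
    using assms unfolding bernstein_def by blast
  then have "b + x \<in> (\<lambda>b. b + x) ` B \<inter> F" "c + x \<in> (UNIV - (\<lambda>b. b + x) ` B) \<inter> F"
    by (auto simp: G_def)
  then show "(\<lambda>b. b + x) ` B \<inter> F \<noteq> {} \<and> (UNIV - (\<lambda>b. b + x) ` B) \<inter> F \<noteq> {}"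
    by blast
qed

section \<open>A criterion for nonmeasurability\<close>

text \<open>Inner regularity: closed subsets exhaust \<open>S\<close> up to measure
  \<open>e\<close>, and here each of them is countable, hence null.\<close>

lemma null_sets_if_closed_subsets_countable:
  fixes S :: "real set"
  assumes "S \<in> sets lebesgue" and "\<And>F. closed F \<Longrightarrow> F \<subseteq> S \<Longrightarrow> countable F"
  shows "S \<in> null_sets lebesgue"
proof -
  \<comment> \<open>The summand 0 matches the shape expected by
    \<open>ennreal_le_epsilon\<close>.\<close>
  have le: "emeasure lebesgue S \<le> 0 + ennreal e" if e: "e > 0" for e
  proof -
    obtain T where T: "closed T" "T \<subseteq> S" "S - T \<in> lmeasurable" "emeasure lebesgue (S - T) < ennreal e"
      using sets_lebesgue_inner_closed[OF assms(1) e] by metis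
    then have "T \<in> null_sets lebesgue"
      using assms(2) by (simp add: countable_imp_null_set_lborel null_sets_completionI)
    then have "emeasure lebesgue (S - T) = emeasure lebesgue S"
      using assms(1) by (rule emeasure_Diff_null_set)
    with T(4) show ?thesis
      by simp
  qed
  have "emeasure lebesgue S \<le> 0"
    by (rule ennreal_le_epsilon) (rule le)
  with assms(1) show ?thesis
    by (simp add: null_sets_def)
qed

text \<open>A closed subset of \<open>- U\<close> misses \<open>X\<close> and one of
  \<open>U\<close> misses \<open>Y\<close>, so both kinds are countable. Measurability would then
  make the whole line a union of two null sets.\<close>

lemma not_lebesgue_if_bernstein_subset_disjoint:
  assumes "bernstein X" "X \<subseteq> U" and "bernstein Y" "Y \<inter> U = {}"
  shows "U \<notin> sets lebesgue"
proof
  assume U: "U \<in> sets lebesgue"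
  then have "- U \<in> sets lebesgue"
    by (metis lborel_eq_real Compl_in_sets_lebesgue)
  then have "- U \<in> null_sets lebesgue"
    using assms(1,2) by (intro null_sets_if_closed_subsets_countable) (auto simp: bernstein_def)
  moreover have "U \<in> null_sets lebesgue"
    using U assms(3,4) by (intro null_sets_if_closed_subsets_countable) (auto simp: bernstein_def)
  ultimately have "U \<union> - U \<in> null_sets lebesgue"
    by (metis null_sets.Un)
  then show False
    by (simp add: null_sets_def)
qed

section \<open>Cosets of a subgroup of the reals\<close>

lemma rcosets_real_add_group:
  "rcosets\<^bsub>real_add_group\<^esub> B = range (\<lambda>x. (\<lambda>b. b + x) ` B)"
  by (auto simp: RCOSETS_def r_coset_def real_add_group_def)

lemma subgroup_real_add_group_iff:
  "subgroup B real_add_group \<longleftrightarrow> 0 \<in> B \<and> (\<forall>x\<in>B. \<forall>y\<in>B. x + y \<in> B) \<and> (\<forall>x\<in>B. - x \<in> B)"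
proof -
  have "inv\<^bsub>real_add_group\<^esub> x = - x" for x
    unfolding m_inv_def real_add_group_def
    by (rule the_equality) auto
  then show ?thesis
    by (auto simp: subgroup_def) (auto simp: real_add_group_def)
qed

lemma invariant_under_rcosets:
  "invariant_under real_translations (rcosets\<^bsub>real_add_group\<^esub> B)"
  unfolding invariant_under_def real_translations_def rcosets_real_add_group
  by (auto simp: image_image add.assoc)

text \<open>
  If \<open>n\<close> cosets covered the reals, then for every \<open>r\<close> two of the multiples \<open>0 s, \<dots>, n s\<close> of
  \<open>s = r / n!\<close> would lie in the same coset, so that some \<open>k s\<close> with \<open>1 \<le> k \<le> n\<close>, and
  hence its multiple \<open>r\<close>, would belong to \<open>B\<close>.
\<close>

lemma proper_subgroup_finite_cosets_not_cover:
  assumes B: "subgroup B real_add_group" "B \<noteq> UNIV"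
    and \<F>: "finite \<F>" "\<F> \<subseteq> rcosets\<^bsub>real_add_group\<^esub> B"
  shows "\<Union>\<F> \<noteq> UNIV"
proof
  assume cover: "\<Union>\<F> = UNIV"
  have sg: "0 \<in> B" "\<And>x y. x \<in> B \<Longrightarrow> y \<in> B \<Longrightarrow> x + y \<in> B" "\<And>x. x \<in> B \<Longrightarrow> - x \<in> B"
    using B(1) by (auto simp: subgroup_real_add_group_iff)
  have mult: "real m * x \<in> B" if "x \<in> B" for m x
    using that by (induction m) (auto simp: sg algebra_simps)
  define n where "n = card \<F>"
  have "r \<in> B" for r
  proof -
    define s where "s = r / fact n"
    have "\<exists>X\<in>\<F>. real i * s \<in> X" for i
      using cover by blast
    then obtain C where C: "\<And>i. C i \<in> \<F>" "\<And>i. real i * s \<in> C i"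
      by metis
    have "card (C ` {0..n}) \<le> n"
      unfolding n_def using C \<F>(1) by (intro card_mono) auto
    then have "\<not> inj_on C {0..n}"
      by (intro pigeonhole) simp
    then obtain i j where ij: "i < j" "j \<le> n" "C i = C j"
      by (auto simp: inj_on_def neq_iff)
    obtain x where "C i = (\<lambda>b. b + x) ` B"
      using C(1)[of i] \<F>(2) unfolding rcosets_real_add_group by blast
    then have "real i * s - x \<in> B" "real j * s - x \<in> B"
      using C(2)[of i] C(2)[of j] ij(3) by auto
    \<comment> \<open>The representative \<open>x\<close> of the common coset cancels in the
      difference.\<close>
    then have "(real j * s - x) + - (real i * s - x) \<in> B"
      using sg by blast
    then have k: "real (j - i) * s \<in> B"
      using ij(1) by (simp add: of_nat_diff algebra_simps)
    \<comment> \<open>Which indices collide is unknown, but \<open>j - i\<close> always lies between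
      1 and \<open>n\<close>. Dividing by \<open>fact n\<close> in \<open>s\<close> makes
      \<open>r\<close> an integer multiple of \<open>(j - i) * s\<close> in every case.\<close>
    have "j - i dvd fact n"
      using ij by (intro dvd_fact) auto
    then obtain m where "fact n = (j - i) * m"
      by (elim dvdE)
    then have "fact n = real m * real (j - i)"
      by (metis mult.commute of_nat_fact of_nat_mult)
    then have "real m * (real (j - i) * s) = fact n * s"
      by simp
    then have "r = real m * (real (j - i) * s)"
      by (simp add: s_def)
    with mult[OF k] show "r \<in> B"
      by metis
  qed
  with B(2) show False
    by blast
qed

lemma finite_unions_bernstein_cosets_not_lebesgue:
  assumes "bernstein B" and sub: "subgroup B real_add_group"
    and "U \<in> finite_unions (rcosets\<^bsub>real_add_group\<^esub> B)"
  shows "U \<notin> sets lebesgue"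
proof -
  have sg: "\<And>x y. x \<in> B \<Longrightarrow> y \<in> B \<Longrightarrow> x + y \<in> B" "\<And>x. x \<in> B \<Longrightarrow> - x \<in> B"
    using sub by (auto simp: subgroup_real_add_group_iff)
  obtain \<F> where \<F>: "U = \<Union>\<F>" "finite \<F>" "\<F> \<noteq> {}" "\<F> \<subseteq> rcosets\<^bsub>real_add_group\<^esub> B"
    using assms(3) unfolding finite_unions_eq by blast
  have "uncountable (UNIV :: real set)"
    by (rule uncountable_UNIV_real)
  \<comment> \<open>The whole line is closed and uncountable, so the complement of \<open>B\<close>
    must meet it.\<close>
  then have "B \<noteq> UNIV"
    using assms(1) unfolding bernstein_def by blast
  with sub \<F> obtain y where y: "y \<notin> U"
    using proper_subgroup_finite_cosets_not_cover by blast
  obtain x where x: "(\<lambda>b. b + x) ` B \<subseteq> U"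
    using \<F> unfolding rcosets_real_add_group by blast
  \<comment> \<open>Cosets that meet coincide: if the coset of \<open>y\<close> met a member of
    \<open>\<F>\<close>, then \<open>y\<close> itself would lie in that member and hence in
    \<open>U\<close>.\<close>
  have "(\<lambda>b. b + y) ` B \<inter> U = {}"
  proof (rule ccontr)
    assume "(\<lambda>b. b + y) ` B \<inter> U \<noteq> {}"
    then obtain b c z where b: "b \<in> B" "c \<in> B" "b + y = c + z" and z: "(\<lambda>b. b + z) ` B \<in> \<F>"
      using \<F> unfolding rcosets_real_add_group by blast
    have "y = (c + - b) + z"
      using b(3) by simp
    moreover have "c + - b \<in> B"
      using b sg by blast
    ultimately have "y \<in> (\<lambda>b. b + z) ` B"
      by blast
    with z y \<F>(1) show False
      by blast
  qed
  then show ?thesis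
    using not_lebesgue_if_bernstein_subset_disjoint bernstein_translation assms(1) x by blast
qed

text \<open>This carries nonmeasurability from a union of cosets \<open>A\<close> to its null
  modification \<open>X\<close>, by contraposition.\<close>

lemma sets_lebesgue_if_null_differences:
  fixes A X :: "real set"
  assumes "X \<in> sets lebesgue" "A - X \<in> null_sets lebesgue" "X - A \<in> null_sets lebesgue"
  shows "A \<in> sets lebesgue"
proof -
  have "A = (X - (X - A)) \<union> (A - X)"
    by blast
  moreover have "(X - (X - A)) \<union> (A - X) \<in> sets lebesgue"
    using sets.Un[OF sets.Diff[OF assms(1) null_setsD2[OF assms(3)]] null_setsD2[OF assms(2)]] .
  ultimately show ?thesis
    by (rule ssubst)
qed

theorem proposition3p2:
  fixes B :: "real set" and \<B> \<N>\<^sub>0 :: "real set set"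
  assumes "bernstein B"
    and "subgroup B real_add_group"
    and "\<B> = rcosets\<^bsub>real_add_group\<^esub> B"
    and "\<N>\<^sub>0 = null_sets lebesgue"
  shows "set_semigroup (family_star (finite_unions \<B>) \<N>\<^sub>0)
    \<and> set_semigroup (family_star \<N>\<^sub>0 (finite_unions \<B>))
    \<and> finite_unions \<B> \<subseteq> family_star \<N>\<^sub>0 (finite_unions \<B>)
    \<and> family_star \<N>\<^sub>0 (finite_unions \<B>) \<subseteq> family_star (finite_unions \<B>) \<N>\<^sub>0
    \<and> invariant_under real_translations (family_star (finite_unions \<B>) \<N>\<^sub>0)
    \<and> invariant_under real_translations (family_star \<N>\<^sub>0 (finite_unions \<B>))
    \<and> (\<forall>A \<in> family_star (finite_unions \<B>) \<N>\<^sub>0. A \<notin> sets lebesgue)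
    \<and> (\<forall>A \<in> family_star \<N>\<^sub>0 (finite_unions \<B>). A \<notin> sets lebesgue)"
proof -
  have inv: "invariant_under real_translations (finite_unions \<B>)"
    "invariant_under real_translations \<N>\<^sub>0"
    unfolding assms(3,4)
    by (rule invariant_under_finite_unions[OF invariant_under_rcosets],
        rule invariant_under_null_sets)
  have "finite_unions \<B> \<noteq> {}"
    by (rule finite_unions_nonempty) (simp add: assms(3) rcosets_real_add_group)
  then have semi: "set_semigroup (family_star (finite_unions \<B>) \<N>\<^sub>0)"
    "set_semigroup (family_star \<N>\<^sub>0 (finite_unions \<B>))"
    unfolding assms(4)
    using set_semigroup_family_star_null_sets_right[OF _ finite_unions_Un]
      set_semigroup_family_star_null_sets_left[OF _ finite_unions_Un] by blast+
  have incl: "finite_unions \<B> \<subseteq> family_star \<N>\<^sub>0 (finite_unions \<B>)"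
    "family_star \<N>\<^sub>0 (finite_unions \<B>) \<subseteq> family_star (finite_unions \<B>) \<N>\<^sub>0"
    unfolding assms(4)
    by (rule subset_family_star_null_sets_left, rule family_star_null_sets_left_subset_right)
  \<comment> \<open>It suffices to treat the larger family; the inclusion in \<open>incl\<close>
    passes the result on to \<open>family_star \<N>\<^sub>0 (finite_unions \<B>)\<close>.\<close>
  have nonmeas: "X \<notin> sets lebesgue" if "X \<in> family_star (finite_unions \<B>) \<N>\<^sub>0" for X
  proof -
    obtain U where "U \<in> finite_unions \<B>" "U - X \<in> null_sets lebesgue" "X - U \<in> null_sets lebesgue"
      using \<open>X \<in> _\<close> unfolding assms(4) family_star_null_sets_right by blast
    then show ?thesis
      using finite_unions_bernstein_cosets_not_lebesgue[OF assms(1,2)]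
        sets_lebesgue_if_null_differences assms(3) by blast
  qed
  have "invariant_under real_translations (family_star (finite_unions \<B>) \<N>\<^sub>0)"
    by (rule invariant_under_family_star[OF inv inj_real_translations])
  moreover have "invariant_under real_translations (family_star \<N>\<^sub>0 (finite_unions \<B>))"
    by (rule invariant_under_family_star[OF inv(2,1) inj_real_translations])
  ultimately show ?thesis
    using semi incl nonmeas by blast
qed

end
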